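(* For every $x\in[0,1]$, \[ \max\{\psi(C) : C\in\mathcal{C},\ \xi(C)=x\}=\sqrt{x}, \] and the maximum is attained uniquely by the Fréchet copula $C^{\mathrm{Fr}}_\alpha(u,v)=(1-\alpha)uv+\alpha\min(u,v)$ with $\alpha=\sqrt{x}$. In particular, $\psi(C)\le\sqrt{\xi(C)}$ for every bivariate copula $C$.
   Context: $\mathcal{C}$ denotes the set of all bivariate copulas, i.e. distribution functions on $[0,1]^2$ with standard uniform marginals. For $C\in\mathcal{C}$, Chatterjee's rank correlation is $\xi(C)=6\int_0^1\int_0^1(\partial_1C(u,v))^2\,du\,dv-2$ (partial derivatives exist a.e.), and Spearman's footrule is $\psi(C)=6\int_0^1 C(u,u)\,du-2$. *)

theory Defs
  imports "HOL-Analysis.Analysis"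
begin

text \<open>Bivariate copula: a function on the unit square that is grounded, has uniform
  margins and is 2-increasing (equivalently, the restriction to [0,1]^2 of a distribution
  function with standard uniform marginals). Values outside [0,1]^2 are irrelevant.\<close>
definition copula :: "(real \<Rightarrow> real \<Rightarrow> real) \<Rightarrow> bool" where
  "copula C \<longleftrightarrow>
     (\<forall>u\<in>{0..1}. C u 0 = 0 \<and> C 0 u = 0 \<and> C u 1 = u \<and> C 1 u = u) \<and>
     (\<forall>u1\<in>{0..1}. \<forall>u2\<in>{0..1}. \<forall>v1\<in>{0..1}. \<forall>v2\<in>{0..1}.
        u1 \<le> u2 \<longrightarrow> v1 \<le> v2 \<longrightarrow>
        C u2 v2 - C u2 v1 - C u1 v2 + C u1 v1 \<ge> 0)"

text \<open>Partial derivative in the first argument, where it exists (set to 0 elsewhere;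
  it exists almost everywhere for a copula).\<close>
definition d1 :: "(real \<Rightarrow> real \<Rightarrow> real) \<Rightarrow> real \<Rightarrow> real \<Rightarrow> real" where
  "d1 C u v = (if (\<lambda>t. C t v) differentiable (at u) then deriv (\<lambda>t. C t v) u else 0)"

definition xi :: "(real \<Rightarrow> real \<Rightarrow> real) \<Rightarrow> real" where
  "xi C = 6 * (LBINT v=0..1. (LBINT u=0..1. (d1 C u v)^2)) - 2"

definition psi :: "(real \<Rightarrow> real \<Rightarrow> real) \<Rightarrow> real" where
  "psi C = 6 * (LBINT u=0..1. C u u) - 2"

definition frechet :: "real \<Rightarrow> real \<Rightarrow> real \<Rightarrow> real" where
  "frechet \<alpha> u v = (1 - \<alpha>) * u * v + \<alpha> * min u v"

end

theory Submission
  imports Defs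
begin

text \<open>Write \<open>h(u, v)\<close> for the partial derivative of \<open>C\<close> in its first argument. Each
  section \<open>C(\<cdot>, v)\<close> is monotone and 1-Lipschitz, so it is the integral of \<open>h(\<cdot>, v)\<close>, and
  expanding the square gives, for every real \<open>a\<close>,
  \<open>6 \<integral>\<integral> (h(u, v) - (1 - a) v - a 1[u \<le> v])\<^sup>2 du dv = \<xi>(C) - 2 a \<psi>(C) + a\<^sup>2\<close>.
  Taking \<open>a = \<psi>(C)\<close> yields \<open>\<psi>(C)\<^sup>2 \<le> \<xi>(C)\<close>; in case of equality \<open>h\<close> is almost everywhere
  the derivative of the Frechet copula with parameter \<open>a\<close>, which determines \<open>C\<close> by integration
  and continuity.\<close>

subsection \<open>Monotone Lipschitz functions as integrals of their derivative\<close>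

lemma continuous_on_mono_lipschitz:
  fixes F :: "real \<Rightarrow> real"
  assumes mono: "\<And>x y. x \<le> y \<Longrightarrow> F x \<le> F y"
    and lip: "\<And>x y. x \<le> y \<Longrightarrow> F y - F x \<le> y - x"
  shows "continuous_on UNIV F"
proof (rule lipschitz_on_continuous_on[of 1], rule lipschitz_onI)
  fix x y show "dist (F x) (F y) \<le> 1 * dist x y"
    using mono[of x y] mono[of y x] lip[of x y] lip[of y x]
    by (cases "x \<le> y") (simp_all add: dist_real_def)
qed simp

text \<open>The interval measures of \<open>F x\<close> and of \<open>x - F x\<close> add up to Lebesgue measure.\<close>

lemma absolutely_continuous_interval_measure:
  fixes F :: "real \<Rightarrow> real"
  assumes mono: "\<And>x y. x \<le> y \<Longrightarrow> F x \<le> F y"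
    and lip: "\<And>x y. x \<le> y \<Longrightarrow> F y - F x \<le> y - x"
  shows "absolutely_continuous lborel (interval_measure F)"
proof -
  define G where "G = (\<lambda>x. x - F x)"
  have cF: "continuous_on UNIV F"
    by (rule continuous_on_mono_lipschitz[OF mono lip])
  then have cG: "continuous_on UNIV G"
    unfolding G_def by (intro continuous_intros)
  have mG: "\<And>x y. x \<le> y \<Longrightarrow> G x \<le> G y"
    using lip by (simp add: G_def algebra_simps)
  define \<mu> where "\<mu> = (\<lambda>A. emeasure (interval_measure F) A + emeasure (interval_measure G) A)"
  define M where "M = measure_of UNIV (sets borel) \<mu>"
  have sM: "sets M = sets borel"
    unfolding M_def by (metis sets.sigma_sets_eq sets_measure_of space_borel subset_UNIV Pow_UNIV)
  have eM: "emeasure M A = \<mu> A" if "A \<in> sets borel" for A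
  proof (rule emeasure_measure_of[OF M_def])
    show "positive (sets M) \<mu>"
      by (simp add: positive_def \<mu>_def)
    show "countably_additive (sets M) \<mu>"
    proof (rule countably_additiveI)
      fix A :: "nat \<Rightarrow> real set"
      assume "range A \<subseteq> sets M" "disjoint_family A"
      then have "(\<Sum>i. emeasure (interval_measure H) (A i)) = emeasure (interval_measure H) (\<Union> (range A))" for H
        by (intro suminf_emeasure) (auto simp: sM)
      then show "(\<Sum>i. \<mu> (A i)) = \<mu> (\<Union> (range A))"
        unfolding \<mu>_def by (simp flip: suminf_add)
    qed
  qed (use that sM in auto)
  have "lborel = M"
  proof (rule lborel_eqI)
    fix l u :: real assume *: "\<And>b. b \<in> Basis \<Longrightarrow> l \<bullet> b \<le> u \<bullet> b"
    then have lu: "l \<le> u" by simp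
    \<comment> \<open>A continuous \<open>H\<close> gives no mass to points, so open and closed
      intervals have the same measure; this bridges the closed intervals of
      \<open>emeasure_interval_measure_Icc\<close> and the open boxes of
      \<open>lborel_eqI\<close>.\<close>
    have single: "emeasure (interval_measure H) {x} = 0" 
      if "\<And>x y. x \<le> y \<Longrightarrow> H x \<le> H y" "continuous_on UNIV H" for H x
      using emeasure_interval_measure_Icc[of x x H] that by simp
    have box: "emeasure (interval_measure H) {l<..<u} = ennreal (H u - H l)" 
      if H: "\<And>x y. x \<le> y \<Longrightarrow> H x \<le> H y" "continuous_on UNIV H" for H
    proof -
      have "emeasure (interval_measure H) {l..u} = emeasure (interval_measure H) ({l<..<u} \<union> ({l} \<union> {u}))"
        using lu by (intro arg_cong[where f="emeasure _"]) auto
      also have "\<dots> = emeasure (interval_measure H) {l<..<u}"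
        by (intro emeasure_Un_null_set null_sets.Un) (auto simp: null_sets_def single H)
      finally show ?thesis
        using emeasure_interval_measure_Icc[of l u H] lu that by simp
    qed
    show "emeasure M (box l u) = (\<Prod>b\<in>Basis. (u - l) \<bullet> b)"
      using mono[OF lu] mG[OF lu] lip[OF lu]
      by (simp add: eM \<mu>_def box cF cG mono mG box_real flip: ennreal_plus) (simp add: G_def)
  qed (simp add: sM)
  \<comment> \<open>A Lebesgue null set is null for the sum \<open>\<mu>\<close>, hence for its
    summand \<open>interval_measure F\<close>.\<close>
  then show ?thesis
    using eM unfolding absolutely_continuous_def null_sets_def \<mu>_def
    by (auto simp: sM)
qed

text \<open>The density is the Radon-Nikodym derivative of \<open>interval_measure F\<close> with
  respect to Lebesgue measure, made real-valued.\<close>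

lemma mono_lipschitz_has_density:
  fixes F :: "real \<Rightarrow> real"
  assumes mono: "\<And>x y. x \<le> y \<Longrightarrow> F x \<le> F y"
    and lip: "\<And>x y. x \<le> y \<Longrightarrow> F y - F x \<le> y - x"
  obtains g :: "real \<Rightarrow> real" where "g \<in> borel_measurable borel" "\<And>x. 0 \<le> g x"
    "\<And>a b. a \<le> b \<Longrightarrow> (g has_integral F b - F a) {a..b}"
proof -
  have cF: "continuous_on UNIV F"
    by (rule continuous_on_mono_lipschitz[OF mono lip])
  obtain f where f: "f \<in> borel_measurable lborel" "density lborel f = interval_measure F"
    using sigma_finite_measure.Radon_Nikodym[OF sigma_finite_lborel absolutely_continuous_interval_measure[OF assms]] by auto
  have [measurable]: "f \<in> borel_measurable borel" using f by simp
  have nn: "(\<integral>\<^sup>+x. f x * indicator {a..b} x \<partial>lborel) = ennreal (F b - F a)" if "a \<le> b" for a b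
  proof -
    have "(\<integral>\<^sup>+x. f x * indicator {a..b} x \<partial>lborel) = emeasure (density lborel f) {a..b}"
      by (simp add: emeasure_density)
    also have "\<dots> = ennreal (F b - F a)"
      unfolding f(2) by (rule emeasure_interval_measure_Icc[OF that mono cF])
    finally show ?thesis .
  qed
  \<comment> \<open>The derivative \<open>f\<close> may take the value infinity, but its integral
    over each bounded interval is finite; hence it is finite almost everywhere and
    \<open>enn2real\<close> changes no integral.\<close>
  have "AE x in lborel. \<forall>n::nat. f x * indicator {-real n..real n} x \<noteq> \<infinity>"
    unfolding AE_all_countable
    by (intro allI nn_integral_PInf_AE) (auto simp: nn)
  then have fin: "AE x in lborel. f x \<noteq> \<infinity>"
  proof eventually_elim
    case (elim x)
    obtain n :: nat where "\<bar>x\<bar> \<le> real n" using real_arch_simple by blast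
    then have "x \<in> {-real n..real n}" by auto
    with elim[rule_format, of n] show ?case by simp
  qed
  define g where "g = (\<lambda>x. enn2real (f x))"
  have [measurable]: "g \<in> borel_measurable borel" unfolding g_def by measurable
  have "(g has_integral F b - F a) {a..b}" if "a \<le> b" for a b
  proof -
    have "((\<lambda>x. g x * indicator {a..b} x) has_integral F b - F a) UNIV"
    proof (rule nn_integral_has_integral)
      have "(\<integral>\<^sup>+x. ennreal (g x * indicator {a..b} x) \<partial>lborel) = (\<integral>\<^sup>+x. f x * indicator {a..b} x \<partial>lborel)"
        by (rule nn_integral_cong_AE)
          (use fin in eventually_elim, auto simp: g_def indicator_def less_top split: if_splits)
      then show "(\<integral>\<^sup>+x. ennreal (g x * indicator {a..b} x) \<partial>lborel) = ennreal (F b - F a)"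
        using nn[OF that] by simp
    qed (auto simp: g_def mono that)
    moreover have "(\<lambda>x. g x * indicator {a..b} x) = (\<lambda>x. if x \<in> {a..b} then g x else 0)"
      by (auto simp: indicator_def)
    ultimately show ?thesis
      by (simp only: has_integral_restrict_UNIV)
  qed
  then show thesis by (intro that[of g]) (auto simp: g_def)
qed

text \<open>The one-sided Lebesgue differentiation theorem. Its exceptional set is Lebesgue null,
  and the completion carries the statement back to \<open>lborel\<close>.\<close>

lemma AE_right_average_tendsto:
  fixes g :: "real \<Rightarrow> real"
  assumes "\<And>a b. g integrable_on {a..b}"
  shows "AE x in lborel. ((\<lambda>h. integral {x..x + h} g / h) \<longlongrightarrow> g x) (at_right 0)"
proof -
  obtain N where N: "negligible N" 
    "\<And>x e. \<lbrakk>x \<notin> N; 0 < e\<rbrakk> \<Longrightarrow> \<exists>d>0. \<forall>h. 0 < h \<and> h < d \<longrightarrow>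
        norm (integral (cbox x (x + h *\<^sub>R One)) g /\<^sub>R h ^ DIM(real) - g x) < e"
    using integrable_ccontinuous_explicit[of g] assms by (metis box_real(2))
  have "AE x in lebesgue. x \<notin> N"
    using N(1) by (simp add: negligible_iff_null_sets AE_not_in)
  then have "AE x in lborel. x \<notin> N"
    by (simp add: AE_completion_iff)
  then show ?thesis
  proof eventually_elim
    case (elim x)
    show ?case
    proof (rule tendstoI)
      fix e :: real assume "0 < e"
      then obtain d where "d > 0" and d: "\<forall>h. 0 < h \<and> h < d \<longrightarrow> 
         norm (integral (cbox x (x + h *\<^sub>R One)) g /\<^sub>R h ^ DIM(real) - g x) < e"
        using N(2)[OF elim] by blast
      then show "\<forall>\<^sub>F h in at_right 0. dist (integral {x..x + h} g / h) (g x) < e"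
        unfolding eventually_at_right_field
        by (intro exI[of _ d]) (auto simp: dist_norm divide_inverse_commute)
    qed
  qed
qed

text \<open>Right difference quotients of \<open>F\<close> are right averages of \<open>g\<close>.
  Left ones become right averages of the reflected function at the reflected point, so both
  one-sided limits come from the same differentiation theorem.\<close>

lemma AE_has_real_derivative_integral:
  fixes F g :: "real \<Rightarrow> real"
  assumes g: "\<And>a b. a \<le> b \<Longrightarrow> (g has_integral F b - F a) {a..b}"
  shows "AE x in lborel. (F has_real_derivative g x) (at x)"
proof -
  have int: "g integrable_on {a..b}" for a b
    using g[of a b] by (cases "a \<le> b") auto
  have int': "(\<lambda>x. g (- x)) integrable_on {a..b}" for a b
    using Henstock_Kurzweil_Integration.integrable_reflect_real[of g "-a" "-b"] int by simp
  \<comment> \<open>Invariance of Lebesgue measure under negation turns "for almost every x" into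
    "for almost every -x".\<close>
  have "AE x in distr lborel borel (uminus :: real \<Rightarrow> real). ((\<lambda>h. integral {x..x + h} (\<lambda>x. g (- x)) / h) \<longlongrightarrow> g (- x)) (at_right 0)"
    unfolding lborel_distr_uminus by (rule AE_right_average_tendsto) (rule int')
  then have "AE x in lborel. ((\<lambda>h. integral {- x..- x + h} (\<lambda>x. g (- x)) / h) \<longlongrightarrow> g x) (at_right 0)"
    by (auto dest!: AE_distrD[rotated])
  with AE_right_average_tendsto[OF int]
  show ?thesis
  proof eventually_elim
    case (elim x)
    have "((\<lambda>h. (F (x + h) - F x) / h) \<longlongrightarrow> g x) (at_right 0)"
    proof (rule Lim_transform_eventually[OF elim(1)])
      show "\<forall>\<^sub>F h in at_right 0. integral {x..x + h} g / h = (F (x + h) - F x) / h"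
        unfolding eventually_at_right_field
        by (intro exI[of _ 1]) (auto intro!: integral_unique g)
    qed
    moreover have "((\<lambda>h. (F (x + - h) - F x) / - h) \<longlongrightarrow> g x) (at_right 0)"
    proof (rule Lim_transform_eventually[OF elim(2)])
      have "integral {- x..- x + h} (\<lambda>x. g (- x)) / h = (F (x + - h) - F x) / - h" if "h > 0" for h
      proof -
        have "integral {- x..- x + h} (\<lambda>x. g (- x)) = integral {x-h..x} g"
          using Henstock_Kurzweil_Integration.integral_reflect_real[of x "x - h" g] by simp
        also have "\<dots> = F x - F (x - h)"
          using that by (intro integral_unique g) auto
        finally show ?thesis using that by (simp add: field_simps)
      qed
      then show "\<forall>\<^sub>F h in at_right 0. integral {- x..- x + h} (\<lambda>x. g (- x)) / h = (F (x + - h) - F x) / - h"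
        unfolding eventually_at_right_field by (intro exI[of _ 1]) auto
    qed
    then have "((\<lambda>h. (F (x + h) - F x) / h) \<longlongrightarrow> g x) (at_left 0)"
      by (simp add: filterlim_at_left_to_right)
    ultimately show ?case
      by (simp add: DERIV_def filterlim_split_at)
  qed
qed

subsection \<open>Borel measurability of partial derivatives\<close>

text \<open>The Cauchy criterion with countable outer quantifiers, so that it exhibits the set of points of
  differentiability of a continuous function as a Borel set.\<close>

lemma tendsto_at_0_iff_Cauchy:
  fixes q :: "real \<Rightarrow> real"
  shows "(\<exists>l. (q \<longlongrightarrow> l) (at 0)) \<longleftrightarrow>
    (\<forall>n::nat. \<exists>k::nat. \<forall>h\<in>{h. h \<noteq> 0 \<and> \<bar>h\<bar> < 1 / Suc k}. \<forall>h'\<in>{h. h \<noteq> 0 \<and> \<bar>h\<bar> < 1 / Suc k}.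
      \<bar>q h - q h'\<bar> \<le> 1 / Suc n)"
    (is "?L \<longleftrightarrow> ?R")
proof
  assume ?L
  then obtain l where l: "(q \<longlongrightarrow> l) (at 0)" ..
  show ?R
  proof
    fix n :: nat
    define e where "e = 1 / real (Suc n)"
    have "e / 2 > 0" by (simp add: e_def)
    from tendstoD[OF l this]
    obtain d where "d > 0" and d: "\<And>h. h \<noteq> 0 \<Longrightarrow> \<bar>h\<bar> < d \<Longrightarrow> \<bar>q h - l\<bar> < e / 2"
      by (auto simp: eventually_at dist_real_def)
    obtain k :: nat where k: "1 / Suc k < d"
      using nat_approx_posE[OF \<open>d > 0\<close>] by metis
    have "\<bar>q h - q h'\<bar> \<le> e" if "h \<noteq> 0" "h' \<noteq> 0" "\<bar>h\<bar> < 1 / Suc k" "\<bar>h'\<bar> < 1 / Suc k" for h h'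
    proof -
      have "\<bar>q h - l\<bar> < e / 2" "\<bar>q h' - l\<bar> < e / 2"
        using that k by (intro d; linarith)+
      then show ?thesis by linarith
    qed
    then show "\<exists>k. \<forall>h\<in>{h. h \<noteq> 0 \<and> \<bar>h\<bar> < 1 / Suc k}. \<forall>h'\<in>{h. h \<noteq> 0 \<and> \<bar>h\<bar> < 1 / Suc k}.
      \<bar>q h - q h'\<bar> \<le> 1 / Suc n"
      unfolding e_def by blast
  qed
next
  assume R: ?R
  have Cauchy: "\<exists>k. \<forall>h h'. h \<noteq> 0 \<longrightarrow> h' \<noteq> 0 \<longrightarrow> \<bar>h\<bar> < 1 / Suc k \<longrightarrow> \<bar>h'\<bar> < 1 / Suc k \<longrightarrow> \<bar>q h - q h'\<bar> < e"
    if "e > 0" for e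
  proof -
    obtain n :: nat where n: "1 / Suc n < e" using nat_approx_posE[OF \<open>e > 0\<close>] by metis
    obtain k where "\<forall>h\<in>{h. h \<noteq> 0 \<and> \<bar>h\<bar> < 1 / Suc k}. \<forall>h'\<in>{h. h \<noteq> 0 \<and> \<bar>h\<bar> < 1 / Suc k}.
      \<bar>q h - q h'\<bar> \<le> 1 / Suc n"
      using R by blast
    with n show ?thesis by (intro exI[of _ k]) force
  qed
  \<comment> \<open>The strict inequality requires i to exceed k, so the tail starts at
    \<open>Suc k\<close>.\<close>
  have small: "\<bar>1 / real (Suc i)\<bar> < 1 / Suc k" if "i \<ge> Suc k" for i k
    using that by (simp add: field_simps)
  have "convergent (\<lambda>m. q (1 / Suc m))"
  proof (rule Cauchy_convergent, rule metric_CauchyI)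
    fix e :: real assume "e > 0"
    from Cauchy[OF this] obtain k where k: "\<forall>h h'. h \<noteq> 0 \<longrightarrow> h' \<noteq> 0 \<longrightarrow> \<bar>h\<bar> < 1 / Suc k \<longrightarrow> \<bar>h'\<bar> < 1 / Suc k \<longrightarrow> \<bar>q h - q h'\<bar> < e" ..
    have "dist (q (1 / Suc i)) (q (1 / Suc j)) < e" if "i \<ge> Suc k" "j \<ge> Suc k" for i j
      unfolding dist_real_def by (rule k[rule_format]) (use small that in auto)
    then show "\<exists>M. \<forall>m\<ge>M. \<forall>n\<ge>M. dist (q (1 / real (Suc m))) (q (1 / real (Suc n))) < e" by blast
  qed
  then obtain l where l: "(\<lambda>m. q (1 / Suc m)) \<longlonglongrightarrow> l" by (auto simp: convergent_def)
  have "(q \<longlongrightarrow> l) (at 0)"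
  proof (rule tendstoI)
    fix e :: real assume "e > 0"
    then have "e / 2 > 0" by simp
    from Cauchy[OF this] obtain k where k: "\<forall>h h'. h \<noteq> 0 \<longrightarrow> h' \<noteq> 0 \<longrightarrow> \<bar>h\<bar> < 1 / Suc k \<longrightarrow> \<bar>h'\<bar> < 1 / Suc k \<longrightarrow> \<bar>q h - q h'\<bar> < e / 2" ..
    \<comment> \<open>Compare \<open>q h\<close> with the sequence defining \<open>l\<close> and let
      m tend to infinity. The limit only preserves a weak inequality, hence the bound e / 2 rather
      than e.\<close>
    have "\<bar>q h - l\<bar> \<le> e / 2" if "h \<noteq> 0" "\<bar>h\<bar> < 1 / Suc k" for h
    proof (rule tendsto_upperbound)
      show "(\<lambda>m. \<bar>q h - q (1 / Suc m)\<bar>) \<longlonglongrightarrow> \<bar>q h - l\<bar>"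
        by (intro tendsto_intros l)
      show "\<forall>\<^sub>F m in sequentially. \<bar>q h - q (1 / Suc m)\<bar> \<le> e / 2"
        by (rule eventually_sequentiallyI[of "Suc k"], rule less_imp_le, rule k[rule_format])
          (use small that in auto)
    qed simp
    then have "\<forall>h. h \<noteq> 0 \<and> dist h 0 < 1 / Suc k \<longrightarrow> dist (q h) l < e"
      using \<open>e > 0\<close> by (force simp: dist_real_def)
    then show "\<forall>\<^sub>F h in at 0. dist (q h) l < e"
      unfolding eventually_at by (intro exI[of _ "1 / Suc k"]) simp
  qed
  then show ?L ..
qed

text \<open>The value 0 at points of non-differentiability is that of \<open>d1\<close>.\<close>

definition deriv0 :: "(real \<Rightarrow> real) \<Rightarrow> real \<Rightarrow> real" where
  "deriv0 F x = (if F differentiable (at x) then deriv F x else 0)"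

text \<open>For fixed increments the difference quotient is continuous in the point. The uncountable
  inner intersections are therefore intersections of closed sets, and only countable operations
  remain outside. On the resulting Borel set the derivative is the limit of the quotients with
  increments 1 / (n + 1).\<close>

lemma borel_measurable_partial_derivative:
  fixes H :: "real \<Rightarrow> real \<Rightarrow> real"
  assumes H: "continuous_on UNIV (\<lambda>(x, y). H x y)"
  shows "(\<lambda>(x, y). deriv0 (\<lambda>t. H t y) x) \<in> borel_measurable borel"
proof -
  define G where "G = (\<lambda>(x, y). H x y)"
  have G: "continuous_on UNIV G" using H by (simp add: G_def)
  define q where "q = (\<lambda>p h. (G (fst p + h, snd p) - G p) / h)"
  \<comment> \<open>For h = 0 the quotient is a division by zero, hence the constant 0.\<close>
  have cq: "continuous_on UNIV (\<lambda>p. q p h)" for h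
    unfolding q_def by (cases "h = 0") (auto intro!: continuous_intros continuous_on_compose2[OF G])
  have qiff: "((\<lambda>t. G (t, snd p)) has_real_derivative l) (at (fst p)) \<longleftrightarrow> (q p \<longlongrightarrow> l) (at 0)" for p l
    by (simp add: DERIV_def q_def[abs_def])
  define D where "D = {p. \<exists>l. (q p \<longlongrightarrow> l) (at 0)}"
  have diff: "(\<lambda>t. G (t, snd p)) differentiable (at (fst p)) \<longleftrightarrow> p \<in> D" for p
    by (simp add: real_differentiable_def qiff D_def)
  have "D = (\<Inter>n::nat. \<Union>k::nat. \<Inter>h\<in>{h. h \<noteq> 0 \<and> \<bar>h\<bar> < 1 / Suc k}. \<Inter>h'\<in>{h. h \<noteq> 0 \<and> \<bar>h\<bar> < 1 / Suc k}.
      {p. \<bar>q p h - q p h'\<bar> \<le> 1 / Suc n})"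
    unfolding D_def tendsto_at_0_iff_Cauchy by (intro set_eqI) (simp only: mem_Collect_eq INT_iff UN_iff UNIV_I ball_simps bex_simps simp_thms)
  also have "\<dots> \<in> sets borel"
    by (intro sets.countable_INT'' sets.countable_UN'' borel_closed closed_INT ballI closed_Collect_le continuous_intros cq) auto
  finally have D [measurable]: "D \<in> sets borel" .
  have [measurable]: "(\<lambda>p. q p h) \<in> borel_measurable borel" for h
    by (intro borel_measurable_continuous_onI cq)
  have "(\<lambda>p. if p \<in> D then deriv (\<lambda>t. G (t, snd p)) (fst p) else 0) \<in> borel_measurable borel"
  proof (rule borel_measurable_LIMSEQ_real)
    show "(\<lambda>n. if p \<in> D then q p (1 / Suc n) else 0) \<longlonglongrightarrow> (if p \<in> D then deriv (\<lambda>t. G (t, snd p)) (fst p) else 0)" for p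
    proof (cases "p \<in> D")
      case True
      then obtain l where l: "(q p \<longlongrightarrow> l) (at 0)" by (auto simp: D_def)
      then have "deriv (\<lambda>t. G (t, snd p)) (fst p) = l"
        by (intro DERIV_imp_deriv) (simp add: qiff)
      moreover have "(\<lambda>n. q p (1 / Suc n)) \<longlonglongrightarrow> l"
      proof (rule filterlim_compose[OF l])
        show "filterlim (\<lambda>n. 1 / real (Suc n)) (at 0) sequentially"
          using LIMSEQ_inverse_real_of_nat by (auto simp: filterlim_at inverse_eq_divide)
      qed
      ultimately show ?thesis using True by simp
    qed simp
  qed measurable
  moreover have "deriv0 (\<lambda>t. G (t, snd p)) (fst p) = (if p \<in> D then deriv (\<lambda>t. G (t, snd p)) (fst p) else 0)" for p
    by (simp add: deriv0_def diff)
  ultimately show ?thesis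
    by (simp add: case_prod_unfold G_def)
qed


text \<open>Both \<open>F x\<close> and \<open>x - F x\<close> are nondecreasing, so their
  derivatives are nonnegative; the default value 0 also lies in the unit interval.\<close>

lemma deriv0_bounds:
  assumes mono: "\<And>x y. x \<le> y \<Longrightarrow> F x \<le> F y"
    and lip: "\<And>x y. x \<le> y \<Longrightarrow> F y - F x \<le> y - x"
  shows "0 \<le> deriv0 F x" "deriv0 F x \<le> 1"
proof -
  have "0 \<le> l \<and> l \<le> 1" if l: "(F has_real_derivative l) (at x)" for l
  proof
    show "0 \<le> l"
      using mono_on_imp_deriv_nonneg[of UNIV F l x] l mono by (auto simp: mono_on_def)
    have "((\<lambda>x. x - F x) has_real_derivative 1 - l) (at x)"
      by (intro derivative_intros l)
    moreover have "mono_on UNIV (\<lambda>x. x - F x)"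
      using lip by (auto simp: mono_on_def algebra_simps)
    ultimately show "l \<le> 1"
      using mono_on_imp_deriv_nonneg[of UNIV "\<lambda>x. x - F x" "1 - l" x] by auto
  qed
  then show "0 \<le> deriv0 F x" "deriv0 F x \<le> 1"
    unfolding deriv0_def by (auto simp: real_differentiable_def dest: DERIV_imp_deriv)
qed

lemma integral_deriv0_mono_lipschitz:
  fixes F :: "real \<Rightarrow> real"
  assumes mono: "\<And>x y. x \<le> y \<Longrightarrow> F x \<le> F y"
    and lip: "\<And>x y. x \<le> y \<Longrightarrow> F y - F x \<le> y - x"
    and meas [measurable]: "deriv0 F \<in> borel_measurable borel" and ab: "a \<le> b"
  shows "(LINT x:{a..b}|lborel. deriv0 F x) = F b - F a"
proof -
  obtain g where g: "\<And>a b. a \<le> b \<Longrightarrow> (g has_integral F b - F a) {a..b}"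
    using mono_lipschitz_has_density[OF mono lip] by metis
  have "AE x in lborel. deriv0 F x = g x"
    using AE_has_real_derivative_integral[where F = F and g = g, OF g, simplified]
    by eventually_elim (auto simp: deriv0_def real_differentiable_def dest: DERIV_imp_deriv)
  then obtain N where N: "N \<in> null_sets lborel" "{x. deriv0 F x \<noteq> g x} \<subseteq> N"
    unfolding eventually_ae_filter by auto
  then have "negligible N"
    by (simp add: negligible_iff_null_sets null_sets_completionI)
  then have "(deriv0 F has_integral F b - F a) {a..b}"
    using N(2) by (intro has_integral_spike[OF _ _ g[OF ab]]) auto
  \<comment> \<open>Boundedness and measurability give Lebesgue integrability, so the gauge integral
    just found is also the Lebesgue integral.\<close>
  moreover have "set_integrable lborel {a..b} (deriv0 F)"
    by (rule set_integrable_bound[of _ _ "\<lambda>_. 1 :: real"])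
      (use deriv0_bounds[OF mono lip] in \<open>auto intro!: integrable_real_indicator simp: set_borel_measurable_def set_integrable_def emeasure_lborel_Icc_eq\<close>)
  ultimately show ?thesis
    by (metis set_borel_integral_eq_integral(2) integral_unique)
qed

subsection \<open>Sections of copulas\<close>

definition clip :: "real \<Rightarrow> real" where
  "clip x = max 0 (min 1 x)"

lemma clip_in_unit [simp]: "0 \<le> clip x" "clip x \<le> 1"
  by (auto simp: clip_def)

lemma clip_eq [simp]: "0 \<le> x \<Longrightarrow> x \<le> 1 \<Longrightarrow> clip x = x"
  by (auto simp: clip_def)

lemma clip_mono: "x \<le> y \<Longrightarrow> clip x \<le> clip y"
  by (auto simp: clip_def)

lemma clip_lipschitz: "x \<le> y \<Longrightarrow> clip y - clip x \<le> y - x"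
  by (auto simp: clip_def)

text \<open>A copula is unspecified outside the unit square, so its sections are extended by constants
  before results about functions on the whole line are applied.\<close>

definition clipped_section :: "(real \<Rightarrow> real \<Rightarrow> real) \<Rightarrow> real \<Rightarrow> real \<Rightarrow> real" where
  "clipped_section C v u = C (clip u) (clip v)"

lemma copulaD:
  assumes "copula C" "0 \<le> u" "u \<le> 1"
  shows "C u 0 = 0" "C 0 u = 0" "C u 1 = u" "C 1 u = u"
  using assms unfolding copula_def by auto

lemma copula_2_increasing:
  assumes "copula C" "0 \<le> u1" "u1 \<le> u2" "u2 \<le> 1" "0 \<le> v1" "v1 \<le> v2" "v2 \<le> 1"
  shows "C u1 v2 - C u1 v1 \<le> C u2 v2 - C u2 v1"
proof -
  have "C u2 v2 - C u2 v1 - C u1 v2 + C u1 v1 \<ge> 0"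
    using assms unfolding copula_def by auto
  then show ?thesis by linarith
qed

text \<open>Rectangles with an edge at 0 give monotonicity because \<open>C\<close> is grounded;
  rectangles with an edge at 1 give the Lipschitz bound because the margins are uniform. Clipping is
  itself monotone and 1-Lipschitz.\<close>

lemma clipped_section_mono_lipschitz:
  assumes "copula C" "x \<le> y"
  shows "clipped_section C v x \<le> clipped_section C v y" "clipped_section C v y - clipped_section C v x \<le> y - x"
    and "clipped_section C x v \<le> clipped_section C y v" "clipped_section C y v - clipped_section C x v \<le> y - x"
  using copula_2_increasing[OF assms(1), of "clip x" "clip y" 0 "clip v"]
    copula_2_increasing[OF assms(1), of "clip x" "clip y" "clip v" 1]
    copula_2_increasing[OF assms(1), of 0 "clip v" "clip x" "clip y"]
    copula_2_increasing[OF assms(1), of "clip v" 1 "clip x" "clip y"]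
    copulaD[OF assms(1), of "clip x"] copulaD[OF assms(1), of "clip y"]
    clip_mono[OF assms(2)] clip_lipschitz[OF assms(2)]
  by (auto simp: clipped_section_def)

lemma continuous_on_clipped_section:
  assumes "copula C"
  shows "continuous_on UNIV (\<lambda>(u, v). clipped_section C v u)"
proof (rule lipschitz_on_continuous_on[of 2], rule lipschitz_onI)
  have 1: "\<bar>clipped_section C v x - clipped_section C v y\<bar> \<le> \<bar>x - y\<bar>" for v x y
    using clipped_section_mono_lipschitz(1,2)[OF assms, of x y v] clipped_section_mono_lipschitz(1,2)[OF assms, of y x v]
    by (cases "x \<le> y") auto
  have 2: "\<bar>clipped_section C x v - clipped_section C y v\<bar> \<le> \<bar>x - y\<bar>" for v x y
    using clipped_section_mono_lipschitz(3,4)[OF assms, of x y v] clipped_section_mono_lipschitz(3,4)[OF assms, of y x v]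
    by (cases "x \<le> y") auto
  fix p q :: "real \<times> real"
  show "dist (case p of (u, v) \<Rightarrow> clipped_section C v u) (case q of (u, v) \<Rightarrow> clipped_section C v u) \<le> 2 * dist p q"
    using 1[of "snd p" "fst p" "fst q"] 2[of "snd p" "fst q" "snd q"] dist_fst_le[of p q] dist_snd_le[of p q]
    by (auto simp: dist_real_def case_prod_unfold)
qed simp

lemma borel_measurable_deriv0_clipped_section:
  assumes "copula C"
  shows "(\<lambda>(u, v). deriv0 (clipped_section C v) u) \<in> borel_measurable (borel \<Otimes>\<^sub>M borel)"
  using borel_measurable_partial_derivative[OF continuous_on_clipped_section[OF assms]]
  by (simp add: borel_prod)

text \<open>Differentiation is local, and near an interior point \<open>C\<close> and its clipped
  section agree. At the endpoints \<open>d1\<close> may depend on values of \<open>C\<close> outside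
  the square.\<close>

lemma d1_eq_deriv0_clipped_section:
  assumes "0 < u" "u < 1" "0 \<le> v" "v \<le> 1"
  shows "d1 C u v = deriv0 (clipped_section C v) u"
proof -
  have "\<forall>\<^sub>F t in nhds u. C t v = clipped_section C v t"
    using eventually_nhds_in_open[of "{0<..<1}" u] assms
    by (auto elim!: eventually_mono simp: clipped_section_def)
  then have "((\<lambda>t. C t v) has_real_derivative l) (at u) \<longleftrightarrow> (clipped_section C v has_real_derivative l) (at u)" for l
    by (intro DERIV_cong_ev) auto
  then show ?thesis
    by (simp add: d1_def deriv0_def real_differentiable_def deriv_def)
qed

subsection \<open>Lebesgue measure on the open unit interval\<close>

text \<open>The interval is open because \<open>d1\<close> is determined by the copula only in the
  interior; the endpoints are null.\<close>

definition unit_lborel :: "real measure" where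
  "unit_lborel = restrict_space lborel {0<..<1}"

lemma space_unit_lborel [simp]: "space unit_lborel = {0<..<1}"
  by (simp add: unit_lborel_def space_restrict_space)

lemma emeasure_unit_lborel: "emeasure unit_lborel {0<..<1} = 1"
  by (simp add: unit_lborel_def emeasure_restrict_space)

interpretation unit_lborel: finite_measure unit_lborel
  by (rule finite_measureI) (simp add: emeasure_unit_lborel)

lemma measurable_unit_lborel [measurable (raw)]:
  "f \<in> measurable borel M \<Longrightarrow> f \<in> measurable unit_lborel M"
  by (simp add: unit_lborel_def measurable_restrict_space1)

lemma AE_unit_lborel: "(AE x in lborel. x \<in> {0<..<1} \<longrightarrow> P x) \<longleftrightarrow> (AE x in unit_lborel. P x)"
  unfolding unit_lborel_def by (subst AE_restrict_space_iff) auto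

lemma integral_unit_lborel:
  fixes f :: "real \<Rightarrow> real"
  shows "integral\<^sup>L unit_lborel f = (\<integral>x. indicator {0<..<1} x * f x \<partial>lborel)"
  by (simp add: unit_lborel_def integral_restrict_space)

lemma interval_integral_eq_unit_lborel:
  fixes f :: "real \<Rightarrow> real"
  shows "(LBINT x=0..1. f x) = integral\<^sup>L unit_lborel f"
proof -
  have "(LBINT x=0..1. f x) = (LBINT x=ereal 0..ereal 1. f x)"
    by (simp add: zero_ereal_def one_ereal_def)
  then show ?thesis
    by (simp add: interval_lebesgue_integral_le_eq einterval_eq integral_unit_lborel set_lebesgue_integral_def)
qed

lemma integrable_unit_lborel:
  fixes f :: "real \<Rightarrow> real"
  assumes "f \<in> borel_measurable unit_lborel" "\<And>x. 0 < x \<Longrightarrow> x < 1 \<Longrightarrow> \<bar>f x\<bar> \<le> B"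
  shows "integrable unit_lborel f"
  using assms by (intro unit_lborel.integrable_const_bound[of _ B]) auto

lemma integral_unit_lborel_FTC:
  fixes f F :: "real \<Rightarrow> real"
  assumes "\<And>x. (F has_real_derivative f x) (at x)" "continuous_on UNIV f"
  shows "integral\<^sup>L unit_lborel f = F 1 - F 0"
proof -
  have "(LBINT x=ereal 0..ereal 1. f x) = F 1 - F 0"
    using assms by (intro interval_integral_FTC_finite)
      (auto intro: continuous_on_subset has_vector_derivative_at_within simp: has_real_derivative_iff_has_vector_derivative)
  then show ?thesis
    by (simp add: interval_integral_eq_unit_lborel[symmetric] zero_ereal_def one_ereal_def)
qed

subsection \<open>The quadratic identity\<close>

lemma xi_eq:
  "xi C = 6 * (\<integral>v. (\<integral>u. (deriv0 (clipped_section C v) u)\<^sup>2 \<partial>unit_lborel) \<partial>unit_lborel) - 2"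
  unfolding xi_def interval_integral_eq_unit_lborel
  by (intro arg_cong2[where f="(-)"] arg_cong2[where f="(*)"] Bochner_Integration.integral_cong refl)
    (simp add: d1_eq_deriv0_clipped_section)

lemma psi_eq: "psi C = 6 * (\<integral>v. clipped_section C v v \<partial>unit_lborel) - 2"
  unfolding psi_def interval_integral_eq_unit_lborel
  by (intro arg_cong2[where f="(-)"] arg_cong2[where f="(*)"] Bochner_Integration.integral_cong refl)
    (simp add: clipped_section_def)

lemma integral_indicator_unit_lborel:
  assumes "0 \<le> w" "w \<le> 1"
  shows "(\<integral>u. indicat_real {..w} u \<partial>unit_lborel) = w"
proof -
  have "(\<integral>u. indicat_real {..w} u \<partial>unit_lborel) = (\<integral>u. indicat_real {0..w} u \<partial>lborel)"
    unfolding integral_unit_lborel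
  proof (rule integral_cong_AE)
    show "AE u in lborel. indicator {0<..<1} u * indicator {..w} u = (indicator {0..w} u :: real)"
      using AE_lborel_singleton[of 0] AE_lborel_singleton[of 1]
      by eventually_elim (use assms in \<open>auto simp: indicator_def\<close>)
  qed auto
  then show ?thesis using assms by simp
qed

context
  fixes C assumes C: "copula C"
begin

private abbreviation "h v u \<equiv> deriv0 (clipped_section C v) u"

lemma measurable_h [measurable]: "(\<lambda>u. h v u) \<in> borel_measurable borel"
  using measurable_compose[OF _ borel_measurable_deriv0_clipped_section[OF C], of "\<lambda>u. (u, v)" borel] by simp

lemma h_bounds: "0 \<le> h v u" "h v u \<le> 1"
  using deriv0_bounds[of "clipped_section C v" u] clipped_section_mono_lipschitz[OF C] by auto

text \<open>The boundary term vanishes because \<open>C 0 v = 0\<close>. The choice w = 1 gives the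
  mean of \<open>h v\<close>, w = v gives the diagonal entering \<open>psi\<close>, and general w
  recovers the copula in the equality case.\<close>

lemma integral_h:
  assumes w: "0 \<le> w" "w \<le> 1" and v: "0 \<le> v" "v \<le> 1"
  shows "(\<integral>u. h v u * indicator {..w} u \<partial>unit_lborel) = C w v"
proof -
  have "(\<integral>u. h v u * indicator {..w} u \<partial>unit_lborel) = (\<integral>u. indicator {0..w} u * h v u \<partial>lborel)"
    unfolding integral_unit_lborel
  proof (rule integral_cong_AE)
    show "AE u in lborel. indicator {0<..<1} u * (h v u * indicator {..w} u) = indicator {0..w} u * h v u"
      using AE_lborel_singleton[of 0] AE_lborel_singleton[of 1]
      by eventually_elim (use w in \<open>auto simp: indicator_def\<close>)
  qed measurable
  also have "\<dots> = clipped_section C v w - clipped_section C v 0"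
    using integral_deriv0_mono_lipschitz[of "clipped_section C v" 0 w] clipped_section_mono_lipschitz[OF C] w
    by (simp add: set_lebesgue_integral_def)
  also have "\<dots> = C w v"
    using w v copulaD[OF C, of v] by (simp add: clipped_section_def)
  finally show ?thesis .
qed

lemma integral_h_square_deviation:
  assumes v: "0 < v" "v < 1"
  shows "(\<integral>u. (h v u - (1 - a) * v - a * indicator {..v} u)\<^sup>2 \<partial>unit_lborel) =
    (\<integral>u. (h v u)\<^sup>2 \<partial>unit_lborel) - 2 * a * clipped_section C v v + a\<^sup>2 * v - (1 - a)\<^sup>2 * v\<^sup>2"
proof -
  let ?I = "indicator {..v} :: real \<Rightarrow> real"
  have int [simp]: "integrable unit_lborel (\<lambda>u. (h v u)\<^sup>2)" "integrable unit_lborel (h v)"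
    "integrable unit_lborel (\<lambda>u. h v u * ?I u)" "integrable unit_lborel ?I"
    using h_bounds[of v]
    by (auto intro!: integrable_unit_lborel[of _ 1] simp: power_le_one indicator_def)
  \<comment> \<open>Since the indicator is its own square, the expansion contains only terms whose
    integrals are known, besides the square of \<open>h\<close>.\<close>
  have "(h v u - (1 - a) * v - a * ?I u)\<^sup>2 = (h v u)\<^sup>2 + (1 - a)\<^sup>2 * v\<^sup>2 + (a\<^sup>2 + 2 * a * (1 - a) * v) * ?I u
     - (2 * (1 - a) * v) * h v u - (2 * a) * (h v u * ?I u)" for u
    by (simp add: indicator_def power2_eq_square algebra_simps)
  then have expand: "(\<integral>u. (h v u - (1 - a) * v - a * ?I u)\<^sup>2 \<partial>unit_lborel) =
    (\<integral>u. (h v u)\<^sup>2 \<partial>unit_lborel) + (1 - a)\<^sup>2 * v\<^sup>2 + (a\<^sup>2 + 2 * a * (1 - a) * v) * (\<integral>u. ?I u \<partial>unit_lborel)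
     - (2 * (1 - a) * v) * (\<integral>u. h v u \<partial>unit_lborel) - (2 * a) * (\<integral>u. h v u * ?I u \<partial>unit_lborel)"
    by (simp add: measure_def emeasure_unit_lborel)
  have mean: "(\<integral>u. h v u \<partial>unit_lborel) = v"
  proof -
    have "(\<integral>u. h v u \<partial>unit_lborel) = (\<integral>u. h v u * indicator {..1} u \<partial>unit_lborel)"
      by (rule Bochner_Integration.integral_cong) auto
    then show ?thesis using integral_h[of 1 v] v copulaD(4)[OF C, of v] by simp
  qed
  have "(\<integral>u. ?I u \<partial>unit_lborel) = v" "(\<integral>u. h v u * ?I u \<partial>unit_lborel) = clipped_section C v v"
    using v integral_indicator_unit_lborel[of v] integral_h[of v v] by (simp_all add: clipped_section_def)
  then show ?thesis
    unfolding expand mean by (simp only:) (simp add: power2_eq_square algebra_simps)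
qed

lemma measurable_integral_h_power2 [measurable]:
  "(\<lambda>v. \<integral>u. (h v u)\<^sup>2 \<partial>unit_lborel) \<in> borel_measurable unit_lborel"
proof (rule unit_lborel.borel_measurable_lebesgue_integral)
  \<comment> \<open>Joint measurability was shown with u first; here the outer variable v comes
    first.\<close>
  have "(\<lambda>p. (snd p, fst p)) \<in> measurable (unit_lborel \<Otimes>\<^sub>M unit_lborel) (borel \<Otimes>\<^sub>M borel)"
    by (intro measurable_Pair measurable_compose[OF measurable_fst measurable_unit_lborel]
        measurable_compose[OF measurable_snd measurable_unit_lborel]) auto
  from measurable_compose[OF this borel_measurable_deriv0_clipped_section[OF C]]
  have [measurable]: "(\<lambda>p. h (fst p) (snd p)) \<in> borel_measurable (unit_lborel \<Otimes>\<^sub>M unit_lborel)"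
    by simp
  show "(\<lambda>(v, u). (h v u)\<^sup>2) \<in> borel_measurable (unit_lborel \<Otimes>\<^sub>M unit_lborel)"
    unfolding case_prod_unfold by measurable
qed

lemma integral_h_power2_bounds:
  "0 \<le> (\<integral>u. (h v u)\<^sup>2 \<partial>unit_lborel)" "(\<integral>u. (h v u)\<^sup>2 \<partial>unit_lborel) \<le> 1"
proof -
  show "0 \<le> (\<integral>u. (h v u)\<^sup>2 \<partial>unit_lborel)" by simp
  have "(\<integral>u. (h v u)\<^sup>2 \<partial>unit_lborel) \<le> (\<integral>u. 1 \<partial>unit_lborel)"
    using h_bounds[of v]
    by (intro integral_mono integrable_unit_lborel[of _ 1]) (auto simp: power_le_one)
  then show "(\<integral>u. (h v u)\<^sup>2 \<partial>unit_lborel) \<le> 1"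
    by (simp add: measure_def emeasure_unit_lborel)
qed

lemma measurable_diagonal_clipped_section [measurable]: "(\<lambda>v. clipped_section C v v) \<in> borel_measurable borel"
  using continuous_on_compose2[OF continuous_on_clipped_section[OF C], of UNIV "\<lambda>v. (v, v)"]
  by (intro borel_measurable_continuous_onI) (simp add: continuous_on_Pair continuous_on_id')

lemma diagonal_clipped_section_bounds: "0 \<le> clipped_section C v v" "clipped_section C v v \<le> 1"
  using clipped_section_mono_lipschitz(1)[OF C, of 0 "clip v" v] clipped_section_mono_lipschitz(2)[OF C, of 0 "clip v" v]
    copulaD[OF C, of "clip v"] clip_in_unit[of v]
  by (auto simp: clipped_section_def simp del: clip_in_unit)

text \<open>Integrate the identity for fixed v over v. With the moments 1/2 and 1/3, the normalising
  constants of \<open>xi\<close> and \<open>psi\<close> cancel every other term, leaving a quadratic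
  polynomial in \<open>a\<close>.\<close>

lemma quadratic_deviation:
  defines "Q \<equiv> \<lambda>a v. \<integral>u. (h v u - (1 - a) * v - a * indicator {..v} u)\<^sup>2 \<partial>unit_lborel"
  shows "integrable unit_lborel (Q a)" "integral\<^sup>L unit_lborel (Q a) = (xi C - 2 * a * psi C + a\<^sup>2) / 6"
proof -
  let ?S = "\<lambda>v. \<integral>u. (h v u)\<^sup>2 \<partial>unit_lborel"
  let ?R = "\<lambda>v. ?S v - (2 * a) * clipped_section C v v + a\<^sup>2 * v - (1 - a)\<^sup>2 * v\<^sup>2"
  have Q: "Q a v = ?R v" if "v \<in> space unit_lborel" for v
    using integral_h_square_deviation[of v a] that by (simp add: Q_def)
  have int [simp]: "integrable unit_lborel ?S" "integrable unit_lborel (\<lambda>v. clipped_section C v v)"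
    "integrable unit_lborel (\<lambda>v. v)" "integrable unit_lborel (\<lambda>v. v\<^sup>2)"
    using integral_h_power2_bounds diagonal_clipped_section_bounds
    by (auto intro!: integrable_unit_lborel[of _ 1] simp: power_le_one)
  have "integrable unit_lborel ?R" by simp
  then show "integrable unit_lborel (Q a)"
    by (subst Bochner_Integration.integrable_cong[of _ unit_lborel _ ?R, OF refl Q])
  have "integral\<^sup>L unit_lborel (Q a) = integral\<^sup>L unit_lborel ?R"
    using Q by (rule Bochner_Integration.integral_cong[OF refl])
  also have "\<dots> = integral\<^sup>L unit_lborel ?S - (2 * a) * (\<integral>v. clipped_section C v v \<partial>unit_lborel)
     + a\<^sup>2 * (\<integral>v. v \<partial>unit_lborel) - (1 - a)\<^sup>2 * (\<integral>v. v\<^sup>2 \<partial>unit_lborel)"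
    by simp
  also have "(\<integral>v. v \<partial>unit_lborel) = 1/2"
    by (subst integral_unit_lborel_FTC[of "\<lambda>x. x\<^sup>2 / 2"]) (auto intro!: derivative_eq_intros)
  also have "(\<integral>v. v\<^sup>2 \<partial>unit_lborel) = 1/3"
    by (subst integral_unit_lborel_FTC[of "\<lambda>x. x^3 / 3"]) (auto intro!: derivative_eq_intros continuous_intros)
  finally show "integral\<^sup>L unit_lborel (Q a) = (xi C - 2 * a * psi C + a\<^sup>2) / 6"
    by (simp add: xi_eq psi_eq power2_eq_square field_simps)
qed

lemma psi_power2_le_xi: "(psi C)\<^sup>2 \<le> xi C"
proof -
  \<comment> \<open>The parameter \<open>a = psi C\<close> minimises the quadratic, so it gives the
    sharpest bound.\<close>
  have "0 \<le> (xi C - 2 * psi C * psi C + (psi C)\<^sup>2) / 6"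
    unfolding quadratic_deviation(2)[symmetric] by simp
  then show ?thesis
    by (simp add: power2_eq_square)
qed

text \<open>Here w is fixed. Vanishing of the double integral yields the formula for almost every v,
  continuity in v extends it to the open interval, and the margins settle v = 0 and v = 1.\<close>

lemma eq_frechet_if_psi_power2_eq_xi:
  assumes eq: "(psi C)\<^sup>2 = xi C" and w: "0 \<le> w" "w \<le> 1" and v: "0 \<le> v" "v \<le> 1"
  shows "C w v = frechet (psi C) w v"
proof -
  define a where "a = psi C"
  have *: "C w v = frechet a w v" if 
    v: "0 < v" "v < 1" and zero: "(\<integral>u. (h v u - (1 - a) * v - a * indicator {..v} u)\<^sup>2 \<partial>unit_lborel) = 0" for v
  proof -
    have "integrable unit_lborel (\<lambda>u. (h v u - (1 - a) * v - a * indicator {..v} u)\<^sup>2)"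
    proof (rule integrable_unit_lborel)
      fix u :: real
      have "\<bar>h v u - (1 - a) * v - a * indicator {..v} u\<bar> \<le> 1 + \<bar>(1 - a) * v\<bar> + \<bar>a\<bar>"
        using h_bounds[of v u] by (auto simp: indicator_def)
      then show "\<bar>(h v u - (1 - a) * v - a * indicator {..v} u)\<^sup>2\<bar> \<le> (1 + \<bar>(1 - a) * v\<bar> + \<bar>a\<bar>)\<^sup>2"
        by (simp add: power2_le_iff_abs_le)
    qed measurable
    with zero have ae: "AE u in unit_lborel. h v u = (1 - a) * v + a * indicator {..v} u"
      by (simp add: integral_nonneg_eq_0_iff_AE algebra_simps)
    have "C w v = (\<integral>u. h v u * indicator {..w} u \<partial>unit_lborel)"
      using integral_h w v by simp
    \<comment> \<open>The product of the indicators of \<open>{..v}\<close> and \<open>{..w}\<close>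
      is that of \<open>{..min w v}\<close>; this is the source of the minimum in the Frechet
      copula.\<close>
    also have "\<dots> = (\<integral>u. ((1 - a) * v) * indicator {..w} u + a * indicator {..min w v} u \<partial>unit_lborel)"
    proof (rule integral_cong_AE)
      show "AE u in unit_lborel. h v u * indicator {..w} u = (1 - a) * v * indicator {..w} u + a * indicator {..min w v} u"
        using ae by eventually_elim (auto simp: indicator_def)
    qed measurable
    also have "\<dots> = ((1 - a) * v) * (\<integral>u. indicator {..w} u \<partial>unit_lborel) + a * (\<integral>u. indicator {..min w v} u \<partial>unit_lborel)"
    proof -
      have "integrable unit_lborel (indicat_real {..x})" for x
        by (rule integrable_unit_lborel[of _ 1]) (auto simp: indicator_def)
      then show ?thesis by simp
    qed
    also have "\<dots> = frechet a w v"
      using w v by (subst (1 2) integral_indicator_unit_lborel) (auto simp: frechet_def)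
    finally show ?thesis .
  qed
  \<comment> \<open>At \<open>a = psi C\<close> the quadratic equals
    \<open>xi C - (psi C)\<^sup>2\<close>, which is 0, and the inner integrals are
    nonnegative.\<close>
  have "AE v in unit_lborel. (\<integral>u. (h v u - (1 - a) * v - a * indicator {..v} u)\<^sup>2 \<partial>unit_lborel) = 0"
    using eq quadratic_deviation[of a]
    by (subst integral_nonneg_eq_0_iff_AE[symmetric]) (auto simp: a_def power2_eq_square)
  then have "AE v in unit_lborel. v \<in> {0<..<1} \<longrightarrow> C w v = frechet a w v"
    by eventually_elim (use * in auto)
  then have "AE v in lborel. v \<in> {0<..<1} \<longrightarrow> v \<in> {v. clipped_section C v w = frechet a w v}"
    unfolding AE_unit_lborel[symmetric] by eventually_elim (use w in \<open>auto simp: clipped_section_def\<close>)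
  then have "AE v\<in>{0<..<1} in lebesgue. v \<in> {v. clipped_section C v w = frechet a w v}"
    by (simp add: AE_completion_iff)
  \<comment> \<open>A closed set containing almost every point of an open interval contains the
    whole interval.\<close>
  moreover have "closed {v. clipped_section C v w = frechet a w v}"
    unfolding frechet_def
    by (intro closed_Collect_eq continuous_intros continuous_on_mono_lipschitz clipped_section_mono_lipschitz[OF C])
  ultimately have "clipped_section C v w = frechet a w v" if "v \<in> {0<..<1}" for v
    using mem_closed_if_AE_lebesgue_open[of "{0<..<1}" "{v. clipped_section C v w = frechet a w v}" v] that by auto
  then have "C w v = frechet a w v" if "0 < v" "v < 1"
    using that w by (simp add: clipped_section_def)
  moreover have "C w 0 = frechet a w 0" "C w 1 = frechet a w 1"
    using copulaD[OF C w] w by (simp_all add: frechet_def algebra_simps)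
  ultimately show ?thesis
    using v unfolding a_def by (cases "v = 0"; cases "v = 1") auto
qed

end

subsection \<open>The Frechet copula\<close>

text \<open>A convex combination of the independence and comonotonicity copulas: the mass of a
  rectangle splits into two nonnegative parts.\<close>

lemma copula_frechet:
  assumes "0 \<le> a" "a \<le> 1"
  shows "copula (frechet a)"
proof -
  have "0 \<le> frechet a u2 v2 - frechet a u2 v1 - frechet a u1 v2 + frechet a u1 v1" 
    if "u1 \<le> u2" "v1 \<le> v2" for u1 u2 v1 v2
  proof -
    have "frechet a u2 v2 - frechet a u2 v1 - frechet a u1 v2 + frechet a u1 v1 =
      (1 - a) * ((u2 - u1) * (v2 - v1)) + a * (min u2 v2 - min u2 v1 - min u1 v2 + min u1 v1)"
      by (simp add: frechet_def algebra_simps)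
    also have "\<dots> \<ge> 0"
    proof -
      have "0 \<le> min u2 v2 - min u2 v1 - min u1 v2 + min u1 v1"
        using that by (auto simp: min_def)
      then show ?thesis using assms that by simp
    qed
    finally show ?thesis .
  qed
  then show ?thesis
    unfolding copula_def by (auto simp: frechet_def algebra_simps)
qed

lemma psi_frechet: "psi (frechet a) = a"
proof -
  have "psi (frechet a) = 6 * (\<integral>u. (1 - a) * u\<^sup>2 + a * u \<partial>unit_lborel) - 2"
    by (simp add: psi_def interval_integral_eq_unit_lborel frechet_def power2_eq_square mult.assoc)
  also have "(\<integral>u. (1 - a) * u\<^sup>2 + a * u \<partial>unit_lborel) = (1 - a) / 3 + a / 2"
    by (subst integral_unit_lborel_FTC[of "\<lambda>x. (1 - a) * x^3 / 3 + a * x\<^sup>2 / 2"])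
      (auto intro!: derivative_eq_intros continuous_intros)
  finally show ?thesis by (simp add: field_simps)
qed

text \<open>The quadratic identity is applied to the Frechet copula with its own parameter. The
  deviation then vanishes, and \<open>psi (frechet a) = a\<close> leaves
  \<open>xi (frechet a) - a\<^sup>2 = 0\<close>.\<close>

lemma xi_frechet:
  assumes a: "0 \<le> a" "a \<le> 1"
  shows "xi (frechet a) = a\<^sup>2"
proof -
  have deriv: "deriv0 (clipped_section (frechet a) v) u = (1 - a) * v + a * indicator {..v} u"
    if "0 < u" "u < 1" "0 < v" "v < 1" "u \<noteq> v" for u v
  proof -
    \<comment> \<open>Away from the kink at u = v the minimum is locally either t or the constant
      v.\<close>
    have ev: "\<forall>\<^sub>F t in nhds u. clipped_section (frechet a) v t = (1 - a) * t * v + a * (if u < v then t else v)"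
    proof (cases "u < v")
      case True
      then show ?thesis 
        using eventually_nhds_in_open[of "{0<..<v}" u] that
        by (auto elim!: eventually_mono simp: clipped_section_def frechet_def)
    next
      case False
      then show ?thesis 
        using eventually_nhds_in_open[of "{v<..<1}" u] that
        by (auto elim!: eventually_mono simp: clipped_section_def frechet_def)
    qed
    have "((\<lambda>t. (1 - a) * t * v + a * (if u < v then t else v)) has_real_derivative
        (1 - a) * v + a * indicator {..v} u) (at u)"
      using that by (auto intro!: derivative_eq_intros simp: indicator_def)
    then have "(clipped_section (frechet a) v has_real_derivative (1 - a) * v + a * indicator {..v} u) (at u)"
      using ev by (subst DERIV_cong_ev[OF refl _ refl])
    then show ?thesis
      by (auto simp: deriv0_def real_differentiable_def DERIV_imp_deriv)
  qed
  have "(\<integral>u. (deriv0 (clipped_section (frechet a) v) u - (1 - a) * v - a * indicator {..v} u)\<^sup>2 \<partial>unit_lborel) = 0"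
    if v: "v \<in> space unit_lborel" for v
  proof (rule integral_eq_zero_AE)
    have "AE u in lborel. u \<noteq> v" by (rule AE_lborel_singleton)
    then have "AE u in unit_lborel. u \<noteq> v" 
      unfolding AE_unit_lborel[symmetric] by eventually_elim simp
    then show "AE u in unit_lborel. (deriv0 (clipped_section (frechet a) v) u - (1 - a) * v - a * indicator {..v} u)\<^sup>2 = 0"
      unfolding AE_unit_lborel[symmetric] by eventually_elim (use v deriv in auto)
  qed
  then have "(\<integral>v. (\<integral>u. (deriv0 (clipped_section (frechet a) v) u - (1 - a) * v - a * indicator {..v} u)\<^sup>2 \<partial>unit_lborel) \<partial>unit_lborel) = 0"
    by (rule integral_eq_zero_AE[OF AE_I2])
  then show ?thesis
    unfolding quadratic_deviation(2)[OF copula_frechet[OF a]] psi_frechet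
    by (simp add: power2_eq_square)
qed

theorem mainTheorem1:
  shows "(\<forall>x\<in>{0..1::real}.
            copula (frechet (sqrt x)) \<and> xi (frechet (sqrt x)) = x \<and>
            psi (frechet (sqrt x)) = sqrt x \<and>
            (\<forall>C. copula C \<and> xi C = x \<longrightarrow>
               psi C \<le> sqrt x \<and>
               (psi C = sqrt x \<longrightarrow>
                  (\<forall>u\<in>{0..1}. \<forall>v\<in>{0..1}. C u v = frechet (sqrt x) u v)))) \<and>
         (\<forall>C. copula C \<longrightarrow> psi C \<le> sqrt (xi C))"
proof -
  \<comment> \<open>The step from squares to the root is valid for either sign of
    \<open>psi C\<close>.\<close>
  have le: "psi C \<le> sqrt (xi C)" if "copula C" for C
    using psi_power2_le_xi[OF that] by (rule real_le_rsqrt)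
  have "C u v = frechet (sqrt (xi C)) u v"
    if "copula C" "0 \<le> xi C" "psi C = sqrt (xi C)" "u \<in> {0..1}" "v \<in> {0..1}" for C u v
    using eq_frechet_if_psi_power2_eq_xi[of C u v] that by simp
  with le show ?thesis
    by (auto simp: copula_frechet xi_frechet psi_frechet)
qed

end
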